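(* For every integer $m\geq 1$, $$\sum_{j=0}^{m-1}\frac{\mathcal{E}(2j)\,H_{2m-2j}}{\Gamma(1-2j+2m)\,\Gamma(2j+1)}=\sum_{k=1}^{m}\frac{2^{2k}(2^{2k}-1)\,B_{2k}}{(1-2k+2m)\,\Gamma(2-2k+2m)\,\Gamma(2k+1)}-\frac{1}{2m\,\Gamma(1+2m)}.$$
   Context: $\mathcal{E}(n)$ denotes the $n$-th Euler number, $1/\cosh x=\sum_{n\ge0}\mathcal{E}(n)x^n/n!$ (so $\mathcal{E}(0)=1$, $\mathcal{E}(2)=-1$, $\mathcal{E}(4)=5$). $B_n$ denotes the $n$-th Bernoulli number ($x/(e^x-1)=\sum_{n\ge0}B_nx^n/n!$), and $H_n=\sum_{l=1}^n 1/l$ is the $n$-th harmonic number. *)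

theory Defs
  imports "HOL-Analysis.Analysis"
begin

definition euler_fps :: "real fps" where
  "euler_fps = inverse ((fps_exp 1 + fps_exp (-1)) / fps_const 2)"

definition euler_number :: "nat \<Rightarrow> real" where
  "euler_number n = fact n * fps_nth euler_fps n"

(* The denominator has zero constant term, so this is the exact division of
   power series of positive subdegree, not multiplication by an inverse. *)
definition bernoulli_fps :: "real fps" where
  "bernoulli_fps = fps_X / (fps_exp 1 - 1)"

definition bernoulli_number :: "nat \<Rightarrow> real" where
  "bernoulli_number n = fact n * fps_nth bernoulli_fps n"

lemma euler_fps_expansion: "(\<lambda>x::real. 1 / cosh x) has_fps_expansion euler_fps"
proof -
  have "(\<lambda>x::real. inverse ((exp (1 * x) + exp (-1 * x)) / 2)) has_fps_expansion
      inverse ((fps_exp 1 + fps_exp (-1)) / fps_const 2)"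
    by (intro fps_expansion_intros) auto
  also have "(\<lambda>x::real. inverse ((exp (1 * x) + exp (-1 * x)) / 2)) = (\<lambda>x. 1 / cosh x)"
    by (simp add: cosh_def field_simps)
  finally show ?thesis by (simp add: euler_fps_def)
qed

lemma bernoulli_fps_mult: "bernoulli_fps * (fps_exp 1 - 1) = fps_X"
proof -
  have nz: "fps_nth (fps_exp 1 - 1 :: real fps) 1 \<noteq> 0" by simp
  have "subdegree (fps_exp 1 - 1 :: real fps) = 1"
    by (rule subdegreeI) auto
  then have "(fps_exp 1 - 1 :: real fps) dvd fps_X"
    using nz by (subst fps_dvd_iff) auto
  then show ?thesis by (simp add: bernoulli_fps_def)
qed

end

theory Submission
  imports Defs
begin

text \<open>
  Both sides are coefficients of \<open>x^(2m)\<close> in one power series identity. Put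
  \<open>Ein(x) = \<Sum>n\<ge>1. (-1)^(n+1) x^n / (n n!)\<close>. Then \<open>\<Sum>n. H_n x^n / n! = exp x * Ein x\<close>
  (lemma \<open>harm_egf_eq\<close>). Writing \<open>Ein\<close> as the sum of its even part \<open>A\<close> and its odd part
  \<open>O\<close> and dividing the even part of this identity by \<open>cosh x\<close> gives
  \<open>sech x * (\<Sum>n even. H_n x^n / n!) = A x + tanh x * O x\<close>.
  The left side is the Euler number sum. The coefficient of \<open>A\<close> is
  \<open>-1 / (2m (2m)!)\<close>, and the product \<open>tanh x * O x\<close> gives the Bernoulli number sum because
  \<open>x tanh x = x + B(4x) - B(2x)\<close> with \<open>B(x) = x / (exp x - 1)\<close> (lemma \<open>X_tanh_eq_bernoulli\<close>).
\<close>

definition harm_egf :: "real fps" where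
  "harm_egf = Abs_fps (\<lambda>n. harm n / fact n)"

text \<open>
  Division by zero makes the constant coefficient \<open>0\<close>, as the integral
  \<open>\<integral> (1 - exp (-t)) / t\<close> from \<open>0\<close> to \<open>x\<close> requires; the same holds for its even part below.
\<close>
definition Ein_fps :: "real fps" where
  "Ein_fps = Abs_fps (\<lambda>n. - ((-1) ^ n) / (real n * fact n))"

definition harm_egf_even :: "real fps" where
  "harm_egf_even = Abs_fps (\<lambda>n. if even n then harm n / fact n else 0)"

definition Ein_even :: "real fps" where
  "Ein_even = Abs_fps (\<lambda>n. if even n then - 1 / (real n * fact n) else 0)"

text \<open>
  This is the odd part of \<open>Ein\<close> divided by \<open>X\<close>. The factor \<open>X\<close> is moved to \<open>tanh\<close>, whose product
  with \<open>X\<close> is the series that Bernoulli numbers describe; both factors are then read off at even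
  indices.
\<close>
definition Ein_odd_shift :: "real fps" where
  "Ein_odd_shift = Abs_fps (\<lambda>n. if even n then 1 / (real (n + 1) * fact (n + 1)) else 0)"

text \<open>
  Since \<open>x Ein'(x) = 1 - exp (-x)\<close>, the product \<open>G = exp * Ein\<close> satisfies
  \<open>x G' = x G + exp x - 1\<close>, which on coefficients is the recursion
  \<open>H_(n+1) = H_n + 1 / (n+1)\<close> divided by \<open>n!\<close>.
\<close>
lemma harm_egf_eq: "harm_egf = fps_exp 1 * Ein_fps"
proof -
  let ?G = "fps_exp 1 * Ein_fps :: real fps"
  have "fps_X * fps_deriv Ein_fps = 1 - fps_exp (-1)"
  proof (rule fps_ext)
    fix n show "fps_nth (fps_X * fps_deriv Ein_fps) n = fps_nth (1 - fps_exp (-1) :: real fps) n"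
      by (cases n) (simp_all add: Ein_fps_def fps_X_mult_nth del: fact_Suc of_nat_Suc)
  qed
  moreover have "fps_exp 1 * fps_exp (-1) = (1 :: real fps)"
    by (simp flip: fps_exp_add_mult)
  moreover have "fps_deriv ?G = ?G + fps_exp 1 * fps_deriv Ein_fps"
    by simp
  ultimately have ode: "fps_X * fps_deriv ?G = fps_X * ?G + fps_exp 1 - 1"
    by algebra
  have rec: "real (Suc n) * fps_nth ?G (Suc n) = fps_nth ?G n + 1 / fact (Suc n)" for n
    using arg_cong[OF ode, of "\<lambda>f. fps_nth f (Suc n)"]
    by (simp del: fps_deriv_mult fact_Suc add: fps_X_mult_nth of_nat_Suc)
  have "fps_nth ?G n = harm n / fact n" for n
  proof (induction n)
    case 0
    then show ?case by (simp add: Ein_fps_def harm_def)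
  next
    case (Suc n)
    have "real (Suc n) * fps_nth ?G (Suc n) = real (Suc n) * (harm (Suc n) / fact (Suc n))"
      unfolding rec Suc.IH by (simp add: harm_Suc field_simps del: of_nat_Suc)
    then show ?case
      by (subst (asm) mult_left_cancel) (simp_all del: of_nat_Suc)
  qed
  then show ?thesis by (simp add: fps_eq_iff harm_egf_def)
qed

text \<open>
  The reflection \<open>x \<mapsto> -x\<close> turns \<open>exp x * Ein x\<close> into \<open>exp (-x) * (A x - O x)\<close>; adding the two
  isolates the even part.
\<close>
lemma harm_egf_even_eq:
  "2 * harm_egf_even = (fps_exp 1 + fps_exp (-1)) * Ein_even
     + (fps_exp 1 - fps_exp (-1)) * (fps_X * Ein_odd_shift)"
proof -
  let ?r = "\<lambda>f :: real fps. f oo (fps_const (-1) * fps_X)"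
  have "?r harm_egf = ?r (fps_exp 1) * ?r Ein_fps"
    unfolding harm_egf_eq by (rule fps_compose_mult_distrib) simp
  also have "?r (fps_exp 1) = fps_exp (-1)"
    by (simp only: fps_compose_linear) (simp add: fps_eq_iff)
  finally have reflected: "?r harm_egf = fps_exp (-1) * ?r Ein_fps" .
  have "2 * harm_egf_even = harm_egf + ?r harm_egf"
    by (simp only: fps_compose_linear)
       (simp add: fps_eq_iff harm_egf_def harm_egf_even_def numeral_fps_const)
  moreover have "Ein_fps = Ein_even + fps_X * Ein_odd_shift"
    by (simp add: fps_eq_iff fps_X_mult_nth Ein_fps_def Ein_even_def Ein_odd_shift_def)
  moreover have "?r Ein_fps = Ein_even - fps_X * Ein_odd_shift"
    by (simp only: fps_compose_linear)
       (simp add: fps_eq_iff fps_X_mult_nth Ein_fps_def Ein_even_def Ein_odd_shift_def)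
  ultimately show ?thesis
    using harm_egf_eq reflected by algebra
qed

lemma euler_fps_mult: "euler_fps * (fps_exp 1 + fps_exp (-1)) = 2"
proof -
  have "(fps_exp 1 + fps_exp (-1)) / fps_const 2 * fps_const 2 = (fps_exp 1 + fps_exp (-1) :: real fps)"
    by (simp add: fps_divide_unit mult.assoc inverse_mult_eq_1)
  moreover have "euler_fps * ((fps_exp 1 + fps_exp (-1)) / fps_const 2) = 1"
    unfolding euler_fps_def by (rule inverse_mult_eq_1) (simp add: fps_divide_unit fps_const_inverse)
  ultimately show ?thesis
    by (metis mult.assoc mult_1 numeral_fps_const)
qed

lemma bernoulli_fps_scaled_mult:
  "(bernoulli_fps oo (fps_const c * fps_X)) * (fps_exp c - 1) = fps_const c * fps_X"
proof -
  let ?s = "\<lambda>f :: real fps. f oo (fps_const c * fps_X)"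
  have "?s (fps_exp 1 - 1) = fps_exp c - 1"
    by (simp only: fps_compose_linear) (auto simp: fps_eq_iff)
  moreover have "?s (bernoulli_fps * (fps_exp 1 - 1)) = ?s bernoulli_fps * ?s (fps_exp 1 - 1)"
    by (rule fps_compose_mult_distrib) simp
  ultimately show ?thesis
    by (simp add: bernoulli_fps_mult)
qed

text \<open>
  With \<open>e = exp x\<close>, the difference \<open>4x / (e^4 - 1) - 2x / (e^2 - 1)\<close> has common denominator
  \<open>(e^2 - 1) (e^2 + 1)\<close> and equals \<open>-2x / (e^2 + 1) = x tanh x - x\<close>.
\<close>
lemma X_tanh_eq_bernoulli:
  "fps_X * (euler_fps * (fps_exp 1 - fps_exp (-1)))
     = 2 * (fps_X + (bernoulli_fps oo (fps_const 4 * fps_X)) - (bernoulli_fps oo (fps_const 2 * fps_X)))"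
proof -
  define e where "e = (fps_exp 1 :: real fps)"
  define e' where "e' = (fps_exp (-1) :: real fps)"
  define B2 where "B2 = bernoulli_fps oo (fps_const 2 * fps_X)"
  define B4 where "B4 = bernoulli_fps oo (fps_const 4 * fps_X)"
  have inv: "e * e' = 1"
    unfolding e_def e'_def by (simp flip: fps_exp_add_mult)
  have b2: "B2 * (e ^ 2 - 1) = 2 * fps_X" and b4: "B4 * (e ^ 4 - 1) = 4 * fps_X"
    using bernoulli_fps_scaled_mult[of 2] bernoulli_fps_scaled_mult[of 4]
    by (simp_all add: B2_def B4_def e_def fps_exp_power_mult numeral_fps_const)
  have eu: "euler_fps * (e + e') = 2"
    using euler_fps_mult by (simp add: e_def e'_def)
  have "fps_nth (e ^ 2 - 1) 1 \<noteq> 0"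
    by (simp add: e_def fps_exp_power_mult)
  then have nz: "e ^ 2 - 1 \<noteq> 0" by (metis fps_zero_nth)
  have "(e ^ 2 - 1) * ((fps_X + B4 - B2) * (e ^ 2 + 1)) = (e ^ 2 - 1) * (fps_X * (e ^ 2 - 1))"
    using b2 b4 by algebra
  then have "(fps_X + B4 - B2) * (e ^ 2 + 1) = fps_X * (e ^ 2 - 1)"
    using nz by simp
  then have "(fps_X + B4 - B2) * (e + e') = fps_X * (e - e')"
    using inv by algebra
  then have "fps_X * (euler_fps * (e - e')) = 2 * (fps_X + B4 - B2)"
    using eu by algebra
  then show ?thesis by (simp add: e_def e'_def B2_def B4_def)
qed

lemma euler_harm_egf_even:
  "euler_fps * harm_egf_even = Ein_even
     + (fps_X + (bernoulli_fps oo (fps_const 4 * fps_X)) - (bernoulli_fps oo (fps_const 2 * fps_X)))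
       * Ein_odd_shift" (is "_ = _ + ?T * _")
proof -
  have "2 * (euler_fps * harm_egf_even) = 2 * (Ein_even + ?T * Ein_odd_shift)"
    using harm_egf_even_eq euler_fps_mult X_tanh_eq_bernoulli by algebra
  moreover have "(2 :: real fps) \<noteq> 0" by simp
  ultimately show ?thesis by (metis mult_left_cancel)
qed

lemma fps_mult_nth_even:
  fixes f g :: "'a :: comm_ring_1 fps"
  assumes "\<And>n. odd n \<Longrightarrow> fps_nth g n = 0"
  shows "fps_nth (f * g) (2 * m) = (\<Sum>j\<le>m. fps_nth f (2 * j) * fps_nth g (2 * m - 2 * j))"
proof -
  have "fps_nth (f * g) (2 * m) = (\<Sum>i=0..2 * m. fps_nth f i * fps_nth g (2 * m - i))"
    by (rule fps_mult_nth)
  also have "\<dots> = (\<Sum>i\<in>(\<lambda>j. 2 * j) ` {..m}. fps_nth f i * fps_nth g (2 * m - i))"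
  proof (rule sum.mono_neutral_right)
    show "\<forall>i\<in>{0..2 * m} - (\<lambda>j. 2 * j) ` {..m}. fps_nth f i * fps_nth g (2 * m - i) = 0"
    proof
      fix i assume i: "i \<in> {0..2 * m} - (\<lambda>j. 2 * j) ` {..m}"
      have "odd i"
      proof
        assume "even i"
        then obtain j where "i = 2 * j" by (elim evenE)
        with i show False by auto
      qed
      then have "odd (2 * m - i)" using i by auto
      then show "fps_nth f i * fps_nth g (2 * m - i) = 0" by (simp add: assms)
    qed
  qed auto
  also have "\<dots> = (\<Sum>j\<le>m. fps_nth f (2 * j) * fps_nth g (2 * m - 2 * j))"
    by (subst sum.reindex) (auto simp: inj_on_def)
  finally show ?thesis .
qed

theorem mainTheorem6:
  fixes m :: nat
  assumes "m \<ge> 1"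
  shows "(\<Sum>j = 0..m - 1. euler_number (2 * j) * harm (2 * m - 2 * j) /
            (Gamma (1 - 2 * real j + 2 * real m) * Gamma (2 * real j + 1)))
       = (\<Sum>k = 1..m. 2 ^ (2 * k) * (2 ^ (2 * k) - 1) * bernoulli_number (2 * k) /
            ((1 - 2 * real k + 2 * real m) * Gamma (2 - 2 * real k + 2 * real m)
              * Gamma (2 * real k + 1)))
         - 1 / (2 * real m * Gamma (1 + 2 * real m))"
    (is "(\<Sum>j = 0..m - 1. ?l j) = (\<Sum>k = 1..m. ?r k) - ?c")
proof -
  define T where "T = fps_X + (bernoulli_fps oo (fps_const 4 * fps_X))
    - (bernoulli_fps oo (fps_const 2 * fps_X))"
  \<comment> \<open>The summand \<open>X\<close> of \<open>T\<close> affects only the odd index \<open>1\<close>.\<close>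
  have T_nth: "fps_nth T (2 * k) = 2 ^ (2 * k) * (2 ^ (2 * k) - 1) * fps_nth bernoulli_fps (2 * k)" for k
  proof -
    have "(4::real) ^ (2 * k) = 2 ^ (2 * k) * 2 ^ (2 * k)"
      by (simp flip: power_mult_distrib)
    then show ?thesis
      unfolding T_def fps_compose_linear by (simp add: algebra_simps fps_X_def)
  qed
  have gam: "Gamma (2 * real j + 1) = fact (2 * j)" for j
    using Gamma_fact[of "2 * j", where 'a = real] by (simp add: add.commute)
  have lhs: "fps_nth euler_fps (2 * j) * fps_nth harm_egf_even (2 * m - 2 * j) = ?l j"
    if "j \<le> m" for j
  proof -
    have "1 + real (2 * m - 2 * j) = 1 - 2 * real j + 2 * real m"
      using that by (simp add: of_nat_diff)
    then have "Gamma (1 - 2 * real j + 2 * real m) = fact (2 * m - 2 * j)"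
      using Gamma_fact[of "2 * m - 2 * j", where 'a = real] by metis
    then show ?thesis
      by (simp add: gam euler_number_def harm_egf_even_def)
  qed
  have rhs: "fps_nth T (2 * k) * fps_nth Ein_odd_shift (2 * m - 2 * k) = ?r k" if "k \<le> m" for k
  proof -
    have eqs: "1 + real (2 * m - 2 * k + 1) = 2 - 2 * real k + 2 * real m"
        "real (2 * m - 2 * k + 1) = 1 - 2 * real k + 2 * real m"
      using that by (simp_all add: of_nat_diff)
    then have "Gamma (2 - 2 * real k + 2 * real m) = fact (2 * m - 2 * k + 1)"
      using Gamma_fact[of "2 * m - 2 * k + 1", where 'a = real] by metis
    moreover have "fps_nth Ein_odd_shift (2 * m - 2 * k)
        = 1 / ((1 - 2 * real k + 2 * real m) * fact (2 * m - 2 * k + 1))"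
      unfolding eqs(2)[symmetric] by (simp add: Ein_odd_shift_def del: fact_Suc)
    ultimately show ?thesis
      by (simp add: gam bernoulli_number_def T_nth mult.assoc del: fact_Suc)
  qed
  have "(\<Sum>j = 0..m - 1. ?l j) = (\<Sum>j\<le>m. ?l j)"
    \<comment> \<open>The additional summand \<open>j = m\<close> vanishes because \<open>H_0 = 0\<close>.\<close>
    using assms by (intro sum.mono_neutral_left) (auto simp: harm_def not_le)
  also have "\<dots> = fps_nth (euler_fps * harm_egf_even) (2 * m)"
    by (subst fps_mult_nth_even) (auto simp: harm_egf_even_def[THEN arg_cong, of "\<lambda>f. fps_nth f _"] simp flip: lhs)
  also have "\<dots> = fps_nth Ein_even (2 * m) + fps_nth (T * Ein_odd_shift) (2 * m)"
    unfolding euler_harm_egf_even T_def by simp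
  also have "fps_nth (T * Ein_odd_shift) (2 * m) = (\<Sum>k\<le>m. ?r k)"
    by (subst fps_mult_nth_even) (auto simp: Ein_odd_shift_def intro!: sum.cong simp flip: rhs)
  also have "\<dots> = (\<Sum>k = 1..m. ?r k)"
    \<comment> \<open>The additional summand \<open>k = 0\<close> vanishes because of the factor \<open>2 ^ (2 * k) - 1\<close>.\<close>
    by (intro sum.mono_neutral_right) (auto simp: not_le)
  also have "fps_nth Ein_even (2 * m) = - ?c"
    using Gamma_fact[of "2 * m", where 'a = real] by (simp add: Ein_even_def)
  finally show ?thesis by simp
qed

end
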